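(* Let $m,m',n,n'\ge 1$ be integers, and consider the direct product $K_{m,m'}\times K_{n,n'}$ of two complete bipartite graphs. Then $K_{m,m'}\times K_{n,n'}$ is Type 2 if and only if $m=m'$ and $n=n'$; otherwise, it is Type 1.
   Context: Graphs are finite and simple. $K_{a,b}$ denotes the complete bipartite graph with parts of sizes $a$ and $b$. The direct product $G\times H$ of graphs $G$ and $H$ has vertex set $V(G)\times V(H)$, with $(u,v)$ and $(u',v')$ adjacent if and only if $uu'\in E(G)$ and $vv'\in E(H)$. A $k$-total coloring of a graph $G$ is an assignment of $k$ colors to its elements (vertices and edges) such that any two adjacent vertices, any two adjacent edges (distinct edges sharing an endpoint), and any edge and each of its endpoints receive distinct colors. The total chromatic number $\chi_T(G)$ is the smallest $k$ for which $G$ has a $k$-total coloring. $\Delta(G)$ denotes the maximum degree. $G$ is Type 1 if $\chi_T(G)=\Delta(G)+1$ and Type 2 if $\chi_T(G)=\Delta(G)+2$. *)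

theory Defs
  imports Main
begin

record 'a sgraph =
  vertices :: "'a set"
  edges :: "'a set set"

locale finite_simple_graph =
  fixes G :: "'a sgraph"
  assumes finite_vertices: "finite (vertices G)"
    and edges_wf: "e \<in> edges G \<Longrightarrow> e \<subseteq> vertices G \<and> card e = 2"

definition complete_bipartite :: "nat \<Rightarrow> nat \<Rightarrow> (nat + nat) sgraph" where
  "complete_bipartite a b =
     \<lparr> vertices = Inl ` {..<a} \<union> Inr ` {..<b},
       edges = {{Inl i, Inr j} | i j. i < a \<and> j < b} \<rparr>"

definition direct_product :: "'a sgraph \<Rightarrow> 'b sgraph \<Rightarrow> ('a \<times> 'b) sgraph" where
  "direct_product G H =
     \<lparr> vertices = vertices G \<times> vertices H,
       edges = {{(u, v), (u', v')} | u v u' v'. {u, u'} \<in> edges G \<and> {v, v'} \<in> edges H} \<rparr>"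

definition degree :: "'a sgraph \<Rightarrow> 'a \<Rightarrow> nat" where
  "degree G v = card {e \<in> edges G. v \<in> e}"

text \<open>Meaningful for graphs with at least one vertex.\<close>

definition max_degree :: "'a sgraph \<Rightarrow> nat" where
  "max_degree G = Max (degree G ` vertices G)"

text \<open>The elements of a graph are its vertices, tagged \<open>Inl\<close>, and its edges, tagged \<open>Inr\<close>.\<close>

definition elements :: "'a sgraph \<Rightarrow> ('a + 'a set) set" where
  "elements G = Inl ` vertices G \<union> Inr ` edges G"

text \<open>The \<open>k\<close> available colors are \<open>0, \<dots>, k - 1\<close>; not all of them need to be used.\<close>

definition total_coloring :: "'a sgraph \<Rightarrow> nat \<Rightarrow> ('a + 'a set \<Rightarrow> nat) \<Rightarrow> bool" where
  "total_coloring G k c \<longleftrightarrow>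
     c ` elements G \<subseteq> {..<k} \<and>
     (\<forall>u v. {u, v} \<in> edges G \<longrightarrow> c (Inl u) \<noteq> c (Inl v)) \<and>
     (\<forall>e\<in>edges G. \<forall>f\<in>edges G. e \<noteq> f \<and> e \<inter> f \<noteq> {} \<longrightarrow> c (Inr e) \<noteq> c (Inr f)) \<and>
     (\<forall>e\<in>edges G. \<forall>v\<in>e. c (Inr e) \<noteq> c (Inl v))"

definition total_chromatic_number :: "'a sgraph \<Rightarrow> nat" where
  "total_chromatic_number G = (LEAST k. \<exists>c. total_coloring G k c)"

definition type1 :: "'a sgraph \<Rightarrow> bool" where
  "type1 G \<longleftrightarrow> total_chromatic_number G = max_degree G + 1"

definition type2 :: "'a sgraph \<Rightarrow> bool" where
  "type2 G \<longleftrightarrow> total_chromatic_number G = max_degree G + 2"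

lemma finite_simple_graph_complete_bipartite:
  "finite_simple_graph (complete_bipartite a b)"
  by unfold_locales (auto simp: complete_bipartite_def)

lemma finite_simple_graph_direct_product:
  assumes "finite_simple_graph G" and "finite_simple_graph H"
  shows "finite_simple_graph (direct_product G H)"
proof -
  interpret G: finite_simple_graph G by fact
  interpret H: finite_simple_graph H by fact
  show ?thesis
  proof
    show "finite (vertices (direct_product G H))"
      by (simp add: direct_product_def G.finite_vertices H.finite_vertices)
  next
    fix e assume "e \<in> edges (direct_product G H)"
    then obtain u v u' v' where e: "e = {(u, v), (u', v')}"
      and uu: "{u, u'} \<in> edges G" and vv: "{v, v'} \<in> edges H"
      by (auto simp: direct_product_def)
    have "u \<noteq> u'" using G.edges_wf[OF uu] by auto
    then show "e \<subseteq> vertices (direct_product G H) \<and> card e = 2"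
      using G.edges_wf[OF uu] H.edges_wf[OF vv] e by (auto simp: direct_product_def)
  qed
qed

text \<open>The minimum in \<open>total_chromatic_number\<close> is over a nonempty set.\<close>

lemma (in finite_simple_graph) total_coloring_exists: "\<exists>k c. total_coloring G k c"
proof -
  have fE: "finite (edges G)"
    by (rule finite_subset[of _ "Pow (vertices G)"]) (use edges_wf finite_vertices in auto)
  then have fin: "finite (elements G)"
    by (simp add: elements_def finite_vertices)
  obtain c :: "'a + 'a set \<Rightarrow> nat" where im: "c ` elements G = {..<card (elements G)}"
    and inj: "inj_on c (elements G)"
    using ex_bij_betw_finite_nat[OF fin] by (auto simp: bij_betw_def atLeast0LessThan)
  have V: "Inl v \<in> elements G" if "v \<in> vertices G" for v
    using that by (simp add: elements_def)
  have E: "Inr e \<in> elements G" if "e \<in> edges G" for e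
    using that by (simp add: elements_def)
  have ends: "v \<in> vertices G" if "e \<in> edges G" "v \<in> e" for e v
    using edges_wf that by blast
  have noloop: "u \<noteq> v" if "{u, v} \<in> edges G" for u v
    using edges_wf[OF that] by auto
  have "total_coloring G (card (elements G)) c"
    unfolding total_coloring_def
  proof (intro conjI allI impI ballI)
    show "c ` elements G \<subseteq> {..<card (elements G)}" using im by simp
    show "c (Inl u) \<noteq> c (Inl v)" if "{u, v} \<in> edges G" for u v
      using inj_onD[OF inj _ V V] ends[OF that] noloop[OF that] by blast
    show "c (Inr e) \<noteq> c (Inr f)"
      if "e \<in> edges G" "f \<in> edges G" "e \<noteq> f \<and> e \<inter> f \<noteq> {}" for e f
      using inj_onD[OF inj _ E E] that by blast
    show "c (Inr e) \<noteq> c (Inl v)" if "e \<in> edges G" "v \<in> e" for e v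
      using inj_onD[OF inj _ E V] ends that by blast
  qed
  then show ?thesis by blast
qed

end

(* The direct product of K(m,m') and K(n,n') is the disjoint union of K(mn, m'n') and K(mn', m'n),
   so everything reduces to the total chromatic number of K(p,q), which is max(p,q) + 1 for
   p different from q and p + 2 for p = q. For p < q, colour the edge ij by i + j mod q; the colour
   p + j mod q is then free at the vertex j of the larger part, and one new colour serves the
   smaller part. If p = q, no residue is free and both parts need a new colour: with p + 1 colours
   every vertex would see all colours, so the colour of a vertex u would have to appear on p
   disjoint edges, all avoiding u. *)
theory Submission
  imports Defs "HOL-Number_Theory.Cong"
begin

section \<open>Complete bipartite graphs and unions on a common vertex type\<close>

text \<open>The parts are arbitrary sets in one vertex type, unlike the numbered parts of
  \<open>complete_bipartite\<close>, so that the components of the product, whose vertices are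
  pairs, are literally of this form. Disjointness of the parts is a separate hypothesis where
  needed.\<close>

definition biclique :: "'a set \<Rightarrow> 'a set \<Rightarrow> 'a sgraph" where
  "biclique L R = \<lparr>vertices = L \<union> R, edges = {{x, y} | x y. x \<in> L \<and> y \<in> R}\<rparr>"

text \<open>Both graphs live on the same type, so the decomposition of the product is an equality
  and not merely an isomorphism.\<close>

definition graph_union :: "'a sgraph \<Rightarrow> 'a sgraph \<Rightarrow> 'a sgraph" where
  "graph_union G H = \<lparr>vertices = vertices G \<union> vertices H, edges = edges G \<union> edges H\<rparr>"

lemma vertices_biclique [simp]: "vertices (biclique L R) = L \<union> R"
  by (simp add: biclique_def)

lemma edges_biclique: "edges (biclique L R) = {{x, y} | x y. x \<in> L \<and> y \<in> R}"
  by (simp add: biclique_def)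

lemma edge_bicliqueI [intro]: "x \<in> L \<Longrightarrow> y \<in> R \<Longrightarrow> {x, y} \<in> edges (biclique L R)"
  by (auto simp: edges_biclique)

text \<open>Facts proved for vertices of the left part carry over to the right part by this
  symmetry.\<close>

lemma biclique_commute: "biclique L R = biclique R L"
  by (auto simp: biclique_def insert_commute)

lemma vertices_graph_union [simp]: "vertices (graph_union G H) = vertices G \<union> vertices H"
  and edges_graph_union [simp]: "edges (graph_union G H) = edges G \<union> edges H"
  by (simp_all add: graph_union_def)

lemma finite_simple_graph_biclique:
  assumes "finite L" "finite R" "L \<inter> R = {}"
  shows "finite_simple_graph (biclique L R)"
proof
  show "finite (vertices (biclique L R))" using assms by simp
next
  fix e assume "e \<in> edges (biclique L R)"
  then obtain x y where "e = {x, y}" "x \<in> L" "y \<in> R" by (auto simp: edges_biclique)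
  moreover from this have "x \<noteq> y" using assms by auto
  ultimately show "e \<subseteq> vertices (biclique L R) \<and> card e = 2" by auto
qed

lemma finite_simple_graph_graph_union:
  "finite_simple_graph G \<Longrightarrow> finite_simple_graph H \<Longrightarrow> finite_simple_graph (graph_union G H)"
  unfolding finite_simple_graph_def by auto

subsection \<open>Degrees\<close>

lemma (in finite_simple_graph) finite_edges: "finite (edges G)"
  by (rule finite_subset[of _ "Pow (vertices G)"]) (use edges_wf finite_vertices in auto)

lemma degree_biclique:
  assumes "L \<inter> R = {}" "x \<in> L"
  shows "degree (biclique L R) x = card R"
proof -
  have "{e \<in> edges (biclique L R). x \<in> e} = (\<lambda>y. {x, y}) ` R"
    using assms by (auto simp: edges_biclique)
  moreover have "inj_on (\<lambda>y. {x, y}) R"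
    by (auto simp: inj_on_def doubleton_eq_iff)
  ultimately show ?thesis by (simp add: degree_def card_image)
qed

lemma max_degree_biclique:
  assumes "L \<inter> R = {}" "L \<noteq> {}" "R \<noteq> {}"
  shows "max_degree (biclique L R) = max (card L) (card R)"
proof -
  have "degree (biclique L R) ` L = {card R}"
    using degree_biclique[OF assms(1)] assms(2) by auto
  moreover have "degree (biclique L R) ` R = {card L}"
    using degree_biclique[of R L] assms(1,3) by (subst biclique_commute) (auto simp: Int_commute)
  ultimately show ?thesis by (simp add: max_degree_def image_Un max.commute)
qed

lemma degree_graph_union:
  assumes "finite_simple_graph H" "vertices G \<inter> vertices H = {}" "v \<in> vertices G"
  shows "degree (graph_union G H) v = degree G v"
proof -
  have "v \<notin> e" if "e \<in> edges H" for e
    using that assms finite_simple_graph.edges_wf by blast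
  then have "{e \<in> edges (graph_union G H). v \<in> e} = {e \<in> edges G. v \<in> e}" by auto
  then show ?thesis by (simp add: degree_def)
qed

lemma graph_union_commute: "graph_union G H = graph_union H G"
  by (simp add: graph_union_def Un_commute)

lemma max_degree_graph_union:
  assumes G: "finite_simple_graph G" and H: "finite_simple_graph H"
    and disj: "vertices G \<inter> vertices H = {}"
    and ne: "vertices G \<noteq> {}" "vertices H \<noteq> {}"
  shows "max_degree (graph_union G H) = max (max_degree G) (max_degree H)"
proof -
  have "degree (graph_union G H) ` vertices G = degree G ` vertices G"
    using degree_graph_union[OF H disj] by simp
  moreover have "degree (graph_union G H) ` vertices H = degree H ` vertices H"
    using degree_graph_union[OF G, of H] disj by (simp add: graph_union_commute[of G H] Int_commute)
  ultimately show ?thesis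
    using ne G H by (simp add: max_degree_def image_Un Max_Un finite_simple_graph.finite_vertices)
qed

subsection \<open>Total colorings\<close>

lemma total_coloring_mono:
  "total_coloring G k c \<Longrightarrow> k \<le> l \<Longrightarrow> total_coloring G l c"
  unfolding total_coloring_def by fastforce

lemma total_coloring_subgraph:
  assumes "total_coloring G k c" "vertices H \<subseteq> vertices G" "edges H \<subseteq> edges G"
  shows "total_coloring H k c"
proof -
  have "c ` elements H \<subseteq> c ` elements G" using assms(2,3) by (auto simp: elements_def)
  then have "c ` elements H \<subseteq> {..<k}" using assms(1) unfolding total_coloring_def by auto
  then show ?thesis
    using assms(1) subsetD[OF assms(3)] unfolding total_coloring_def by simp
qed

lemma (in finite_simple_graph) ex_total_coloring_iff:
  "(\<exists>c. total_coloring G k c) \<longleftrightarrow> total_chromatic_number G \<le> k"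
proof
  show "\<exists>c. total_coloring G k c \<Longrightarrow> total_chromatic_number G \<le> k"
    unfolding total_chromatic_number_def by (rule Least_le)
  have "\<exists>c. total_coloring G (total_chromatic_number G) c"
    unfolding total_chromatic_number_def by (rule LeastI_ex) (rule total_coloring_exists)
  then show "total_chromatic_number G \<le> k \<Longrightarrow> \<exists>c. total_coloring G k c"
    using total_coloring_mono by blast
qed

text \<open>Colorings restrict to subgraphs. Conversely, elements of different components are never
  adjacent or incident, so two colorings with the same palette can be glued without
  conflict.\<close>

lemma ex_total_coloring_graph_union_iff:
  assumes G: "finite_simple_graph G" and H: "finite_simple_graph H"
    and disj: "vertices G \<inter> vertices H = {}"
  shows "(\<exists>c. total_coloring (graph_union G H) k c) \<longleftrightarrow>
    (\<exists>c. total_coloring G k c) \<and> (\<exists>c. total_coloring H k c)"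
proof (intro iffI conjI; (elim conjE exE)?)
  fix c assume "total_coloring (graph_union G H) k c"
  then show "\<exists>c. total_coloring G k c" "\<exists>c. total_coloring H k c"
    using total_coloring_subgraph by (metis Un_upper1 Un_upper2 edges_graph_union vertices_graph_union)+
next
  fix a b assume a: "total_coloring G k a" and b: "total_coloring H k b"
  define c where "c = (\<lambda>z. if z \<in> elements G then a z else b z)"
  have endsG: "e \<subseteq> vertices G \<and> e \<noteq> {}" if "e \<in> edges G" for e
    using finite_simple_graph.edges_wf[OF G that] by auto
  have endsH: "e \<subseteq> vertices H \<and> e \<noteq> {}" if "e \<in> edges H" for e
    using finite_simple_graph.edges_wf[OF H that] by auto
  have cG: "c z = a z" if "z \<in> elements G" for z
    using that by (simp add: c_def)
  \<comment> \<open>A common edge would be a nonempty set inside two disjoint vertex sets. This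
    makes the element sets disjoint too, so the default branch of \<open>c\<close> really yields
    \<open>b\<close> on \<open>H\<close>.\<close>
  have "edges G \<inter> edges H = {}"
    using endsG endsH disj by blast
  then have cH: "c z = b z" if "z \<in> elements H" for z
    using that disj by (auto simp: c_def elements_def)
  have sameG: "total_coloring G k c"
    using a endsG cG unfolding total_coloring_def
    by (auto simp: elements_def subset_iff image_subset_iff)
  have sameH: "total_coloring H k c"
    using b endsH cH unfolding total_coloring_def
    by (auto simp: elements_def subset_iff image_subset_iff)
  have "e \<inter> f = {}" if "e \<in> edges G" "f \<in> edges H" for e f
    using endsG endsH disj that by blast
  then have meet: "(e \<in> edges G \<and> f \<in> edges G) \<or> (e \<in> edges H \<and> f \<in> edges H)"
    if "e \<in> edges (graph_union G H)" "f \<in> edges (graph_union G H)" "e \<inter> f \<noteq> {}" for e f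
    using that by (metis Int_commute Un_iff edges_graph_union)
  have "total_coloring (graph_union G H) k c"
    unfolding total_coloring_def
  proof (intro conjI allI impI ballI)
    have "elements (graph_union G H) = elements G \<union> elements H"
      by (auto simp: elements_def)
    then show "c ` elements (graph_union G H) \<subseteq> {..<k}"
      using sameG sameH unfolding total_coloring_def by (simp add: image_Un)
    show "c (Inl u) \<noteq> c (Inl v)" if "{u, v} \<in> edges (graph_union G H)" for u v
      using that sameG sameH unfolding total_coloring_def by auto
    show "c (Inr e) \<noteq> c (Inl v)" if "e \<in> edges (graph_union G H)" "v \<in> e" for e v
      using that sameG sameH unfolding total_coloring_def by auto
    show "c (Inr e) \<noteq> c (Inr f)"
      if "e \<in> edges (graph_union G H)" "f \<in> edges (graph_union G H)" "e \<noteq> f \<and> e \<inter> f \<noteq> {}" for e f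
      using that meet[of e f] sameG sameH unfolding total_coloring_def by metis
  qed
  then show "\<exists>c. total_coloring (graph_union G H) k c" by blast
qed

lemma total_chromatic_number_graph_union:
  assumes G: "finite_simple_graph G" and H: "finite_simple_graph H"
    and disj: "vertices G \<inter> vertices H = {}"
  shows "total_chromatic_number (graph_union G H) =
    max (total_chromatic_number G) (total_chromatic_number H)"
proof -
  \<comment> \<open>Two numbers with the same upper bounds are equal; each upper bound is a
    statement about colorability with \<open>k\<close> colors.\<close>
  have "total_chromatic_number (graph_union G H) \<le> k \<longleftrightarrow>
      max (total_chromatic_number G) (total_chromatic_number H) \<le> k" for k
    using ex_total_coloring_graph_union_iff[OF assms, of k]
    by (simp add: finite_simple_graph.ex_total_coloring_iff finite_simple_graph_graph_union G H)
  then show ?thesis by (meson antisym order_refl)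
qed

text \<open>A vertex and its incident edges conflict pairwise. Hence \<open>k\<close> exceeds every
  degree, and if \<open>k\<close> is the degree plus one, every color occurs at the vertex.\<close>

lemma (in finite_simple_graph) colors_at_vertex:
  assumes c: "total_coloring G k c" and v: "v \<in> vertices G"
  defines "S \<equiv> insert (Inl v) (Inr ` {e \<in> edges G. v \<in> e})"
  shows "c ` S \<subseteq> {..<k}" "card (c ` S) = Suc (degree G v)"
proof -
  have "S \<subseteq> elements G" using v by (auto simp: S_def elements_def)
  then show "c ` S \<subseteq> {..<k}" using c unfolding total_coloring_def by (metis image_mono order_trans)
  have "inj_on c S"
  proof (rule inj_onI)
    have V: "c (Inr e) \<noteq> c (Inl v)" if "e \<in> edges G" "v \<in> e" for e
      using c that unfolding total_coloring_def by blast
    have E: "e = f" if "e \<in> edges G" "v \<in> e" "f \<in> edges G" "v \<in> f" "c (Inr e) = c (Inr f)" for e f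
      using c that unfolding total_coloring_def by (metis disjoint_iff)
    show "x = y" if "x \<in> S" "y \<in> S" "c x = c y" for x y
      using that V V[symmetric] E unfolding S_def by auto
  qed
  then have "card (c ` S) = card S" by (rule card_image)
  also have "\<dots> = Suc (degree G v)"
    using finite_edges unfolding S_def degree_def
    by (subst card_insert_disjoint) (auto simp: card_image)
  finally show "card (c ` S) = Suc (degree G v)" .
qed

lemma (in finite_simple_graph) degree_less_colors:
  assumes "total_coloring G k c" "v \<in> vertices G"
  shows "degree G v < k"
  using card_mono[OF finite_lessThan colors_at_vertex(1)[OF assms]] colors_at_vertex(2)[OF assms]
  by simp

subsection \<open>The total chromatic number of a complete bipartite graph\<close>

text \<open>Cancellation makes the cyclic edge coloring proper and also shows which residue is
  missing at a vertex.\<close>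

lemma add_mod_left_cancel:
  fixes a b c q :: nat
  assumes "(c + a) mod q = (c + b) mod q" "a < q" "b < q"
  shows "a = b"
  using assms cong_add_lcancel_nat[of c a b q] by (simp add: cong_def)

text \<open>The balanced and unbalanced cases share the edge coloring and the color of
  \<open>L\<close>; only the colors of \<open>R\<close> differ. By \<open>le\<close>, the labels of
  both parts lie below \<open>q\<close>, as cancellation modulo \<open>q\<close> requires.\<close>

lemma ex_total_coloring_biclique:
  assumes fin: "finite L" "finite R" and disj: "L \<inter> R = {}"
    and le: "card L \<le> card R"
  shows "\<exists>c. total_coloring (biclique L R) (card R + (if card L = card R then 2 else 1)) c"
proof -
  define p q where "p = card L" and "q = card R"
  obtain f where f: "bij_betw f L {..<p}"
    using ex_bij_betw_finite_nat[OF fin(1)] by (auto simp: p_def atLeast0LessThan)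
  obtain g where g: "bij_betw g R {..<q}"
    using ex_bij_betw_finite_nat[OF fin(2)] by (auto simp: q_def atLeast0LessThan)
  define h where "h v = (if v \<in> L then f v else g v)" for v
  \<comment> \<open>Edges use only residues below \<open>q\<close>, so \<open>q\<close> is new. At a
    vertex \<open>v\<close> of \<open>R\<close> the edges have colors \<open>i + g v\<close> modulo
    \<open>q\<close> with \<open>i < p\<close>; if \<open>p < q\<close>, the residue with
    \<open>i = p\<close> is free, and if \<open>p = q\<close>, a second new color
    \<open>q + 1\<close> is required.\<close>
  define d where "d v = (if v \<in> L then q else if p = q then q + 1 else (p + g v) mod q)" for v
  \<comment> \<open>Summing over the edge as a set avoids having to choose which endpoint lies in
    \<open>L\<close>.\<close>
  define c where "c z = (case z of Inl v \<Rightarrow> d v | Inr e \<Rightarrow> (\<Sum>v\<in>e. h v) mod q)" for z :: "'a + 'a set"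
  have cV: "c (Inl v) = d v" for v by (simp add: c_def)
  have pq: "p \<le> q" using le by (simp add: p_def q_def)
  have RL: "y \<notin> L" if "y \<in> R" for y using that disj by auto
  have hL: "h x < p" if "x \<in> L" for x
    using that f by (auto simp: h_def bij_betw_def)
  have hR: "h y < q" if "y \<in> R" for y
    using that g RL by (auto simp: h_def bij_betw_def)
  have cE: "c (Inr {x, y}) = (h x + h y) mod q" if "x \<in> L" "y \<in> R" for x y
    using that disj by (subgoal_tac "x \<noteq> y") (auto simp: c_def)
  have injL: "x = x'" if "x \<in> L" "x' \<in> L" "h x = h x'" for x x'
    using that f by (auto simp: h_def bij_betw_def dest: inj_onD)
  have injR: "y = y'" if "y \<in> R" "y' \<in> R" "h y = h y'" for y y'
    using that g RL by (auto simp: h_def bij_betw_def dest: inj_onD)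
  have dL: "d x = q" if "x \<in> L" for x using that by (simp add: d_def)
  have dR: "d y = (if p = q then q + 1 else (p + h y) mod q)" if "y \<in> R" for y
    using RL[OF that] by (simp add: d_def h_def)
  \<comment> \<open>\<open>R\<close> may be empty here, so positivity of the modulus is drawn from a
    vertex of \<open>R\<close> whenever a residue is bounded.\<close>
  have qpos: "q > 0" if "y \<in> R" for y using hR[OF that] by simp
  have vert: "d x \<noteq> d y" if "x \<in> L" "y \<in> R" for x y
    using that mod_less_divisor[OF qpos[OF that(2)]] by (auto simp: dL dR less_imp_neq[symmetric])
  have edge_L: "(h x + h y) mod q \<noteq> d x" if "x \<in> L" "y \<in> R" for x y
    using that mod_less_divisor[OF qpos[OF that(2)]] by (simp add: dL less_imp_neq)
  have edge_R: "(h x + h y) mod q \<noteq> d y" if xy: "x \<in> L" "y \<in> R" for x y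
  proof (cases "p = q")
    case True
    have "(h x + h y) mod q < q" using qpos[OF xy(2)] by simp
    then show ?thesis using True dR[OF xy(2)] by simp
  next
    case False
    \<comment> \<open>A collision would cancel to \<open>h x = p\<close>, contradicting
      \<open>h x < p\<close>.\<close>
    then show ?thesis
      using add_mod_left_cancel[of "h y" "h x" q p] hL[OF xy(1)] pq dR[OF xy(2)]
      by (auto simp: add.commute)
  qed
  have "total_coloring (biclique L R) (q + (if p = q then 2 else 1)) c"
    unfolding total_coloring_def
  proof (intro conjI allI impI ballI)
    have "c (Inl v) < q + (if p = q then 2 else 1)" if "v \<in> L \<union> R" for v
      using that dL dR qpos by (auto simp: cV intro: less_SucI)
    moreover have "c (Inr {x, y}) < q + (if p = q then 2 else 1)" if "x \<in> L" "y \<in> R" for x y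
      using cE[OF that] mod_less_divisor[OF qpos[OF that(2)], of "h x + h y"] by simp
    ultimately show "c ` elements (biclique L R) \<subseteq> {..<q + (if p = q then 2 else 1)}"
      unfolding elements_def edges_biclique vertices_biclique by blast
    show "c (Inl u) \<noteq> c (Inl v)" if "{u, v} \<in> edges (biclique L R)" for u v
      using that vert by (auto simp: cV edges_biclique doubleton_eq_iff) metis+
    show "c (Inr e) \<noteq> c (Inl v)" if "e \<in> edges (biclique L R)" "v \<in> e" for e v
      using that edge_L edge_R cE by (auto simp: cV edges_biclique)
    show "c (Inr e) \<noteq> c (Inr e')"
      if ee: "e \<in> edges (biclique L R)" "e' \<in> edges (biclique L R)" "e \<noteq> e' \<and> e \<inter> e' \<noteq> {}" for e e'
    proof
      assume same: "c (Inr e) = c (Inr e')"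
      obtain x y where e: "e = {x, y}" "x \<in> L" "y \<in> R" using ee by (auto simp: edges_biclique)
      obtain x' y' where e': "e' = {x', y'}" "x' \<in> L" "y' \<in> R" using ee by (auto simp: edges_biclique)
      have eq: "(h x + h y) mod q = (h x' + h y') mod q" using same cE e e' by simp
      have bounds: "h x < q" "h x' < q" "h y < q" "h y' < q"
        using hL[OF e(2)] hL[OF e'(2)] hR e e' pq by auto
      \<comment> \<open>As the parts are disjoint, meeting edges share their \<open>L\<close>-end or
        their \<open>R\<close>-end; cancelling its label identifies the other ends.\<close>
      have "x = x' \<or> y = y'" using ee e e' RL by auto
      then have "x = x' \<and> y = y'"
      proof
        assume x: "x = x'"
        then have "h y = h y'" using add_mod_left_cancel eq bounds by blast
        then show ?thesis using injR e e' x by simp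
      next
        assume y: "y = y'"
        then have "h x = h x'"
          using add_mod_left_cancel[of "h y" "h x" q "h x'"] eq bounds by (simp add: add.commute)
        then show ?thesis using injL e e' y by simp
      qed
      then show False using ee e e' by simp
    qed
  qed
  then show ?thesis by (auto simp: p_def q_def)
qed

lemma total_coloring_balanced_biclique_lower:
  assumes fin: "finite L" "finite R" and disj: "L \<inter> R = {}" and ne: "L \<noteq> {}"
    and eq: "card L = card R"
    and c: "total_coloring (biclique L R) k c"
  shows "card R + 2 \<le> k"
proof (rule ccontr)
  assume small: "\<not> card R + 2 \<le> k"
  interpret finite_simple_graph "biclique L R"
    using fin disj by (rule finite_simple_graph_biclique)
  obtain u where u: "u \<in> L" using ne by blast
  have cu: "c (Inl u) < k"
    using c u unfolding total_coloring_def elements_def by auto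
  have "\<exists>x\<in>L. c (Inr {x, y}) = c (Inl u)" if y: "y \<in> R" for y
  proof -
    let ?S = "insert (Inl y) (Inr ` {e \<in> edges (biclique L R). y \<in> e})"
    have "degree (biclique L R) y = card R"
      using degree_biclique[of R L y] disj y eq by (subst biclique_commute) auto
    then have "card (c ` ?S) = Suc (card R)" and sub: "c ` ?S \<subseteq> {..<k}"
      using colors_at_vertex[OF c, of y] y by auto
    \<comment> \<open>At most \<open>card R + 1\<close> colors are available and exactly that many
      occur at \<open>y\<close>, so none is missing.\<close>
    then have "c ` ?S = {..<k}"
      using small card_mono[OF finite_lessThan sub] by (intro card_subset_eq) simp_all
    then have "c (Inl u) \<in> c ` ?S" using cu by simp
    moreover have "c (Inl u) \<noteq> c (Inl y)"
      using c edge_bicliqueI[OF u y] unfolding total_coloring_def by simp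
    ultimately obtain e where e: "e \<in> edges (biclique L R)" "y \<in> e" "c (Inr e) = c (Inl u)"
      by auto
    then obtain x where "x \<in> L" "e = {x, y}" using disj y by (auto simp: edges_biclique)
    then show ?thesis using e by auto
  qed
  \<comment> \<open>\<open>w\<close> matches each \<open>y\<close> to the other end of its edge with
    the color of \<open>u\<close>. These edges avoid \<open>u\<close>, and equally colored edges
    cannot meet, so \<open>w\<close> injects \<open>R\<close> into \<open>L - {u}\<close>, which is
    one element too small.\<close>
  then obtain w where w: "\<And>y. y \<in> R \<Longrightarrow> w y \<in> L \<and> c (Inr {w y, y}) = c (Inl u)"
    by metis
  have "w y \<noteq> u" if "y \<in> R" for y
  proof
    assume "w y = u"
    then have "c (Inr {u, y}) = c (Inl u)" using w[OF that] by simp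
    then show False
      using c edge_bicliqueI[OF u that] unfolding total_coloring_def by blast
  qed
  then have "w ` R \<subseteq> L - {u}" using w by auto
  moreover have "inj_on w R"
  proof
    fix y y' assume y: "y \<in> R" "y' \<in> R" "w y = w y'"
    have "{w y, y} \<in> edges (biclique L R)" "{w y', y'} \<in> edges (biclique L R)"
      using w y by auto
    then have "{w y, y} = {w y', y'}"
      using c w[of y] w[of y'] y unfolding total_coloring_def by (metis disjoint_iff insertI1)
    then show "y = y'" using y by (auto simp: doubleton_eq_iff)
  qed
  ultimately have "card R \<le> card (L - {u})"
    using fin card_inj_on_le by blast
  then show False using u fin eq card_Diff1_less[of L u] by simp
qed

lemma total_chromatic_number_biclique:
  assumes fin: "finite L" "finite R" and disj: "L \<inter> R = {}" and ne: "L \<noteq> {}" "R \<noteq> {}"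
  shows "total_chromatic_number (biclique L R) =
    max (card L) (card R) + (if card L = card R then 2 else 1)" (is "?chi L R = ?k L R")
  using assms
\<comment> \<open>The claim is symmetric in the two parts, so \<open>card L \<le> card R\<close> may
  be assumed.\<close>
proof (induction "card L" "card R" arbitrary: L R rule: linorder_wlog)
  case sym
  have "?chi R L = ?k R L"
    using sym.prems by (intro sym.hyps) auto
  then show ?case by (simp add: biclique_commute[of L] max.commute eq_commute[of "card L"])
next
  case le
  interpret finite_simple_graph "biclique L R"
    using le by (intro finite_simple_graph_biclique)
  show ?case
  proof (rule antisym)
    show "?chi L R \<le> ?k L R"
      using ex_total_coloring_biclique[of L R] le unfolding ex_total_coloring_iff by auto
    obtain c where c: "total_coloring (biclique L R) (?chi L R) c"
      using ex_total_coloring_iff by blast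
    obtain x where x: "x \<in> L" using le by blast
    \<comment> \<open>A vertex of the smaller part has the maximum degree,
      \<open>card R\<close>.\<close>
    have "card R < ?chi L R"
      using degree_less_colors[OF c, of x] degree_biclique[of L R x] x le by simp
    moreover have "card R + 2 \<le> ?chi L R" if "card L = card R"
      using total_coloring_balanced_biclique_lower[OF _ _ _ _ that c] le by blast
    ultimately show "?k L R \<le> ?chi L R" using le by auto
  qed
qed

subsection \<open>Direct products of complete bipartite graphs\<close>

text \<open>Each edge switches sides in both coordinates at once, so whether the two coordinates lie
  on equal or opposite sides is invariant along edges. The two cases give the two bicliques.\<close>

lemma direct_product_complete_bipartite:
  "direct_product (complete_bipartite m m') (complete_bipartite n n') =
    graph_union
      (biclique (Inl ` {..<m} \<times> Inl ` {..<n}) (Inr ` {..<m'} \<times> Inr ` {..<n'}))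
      (biclique (Inl ` {..<m} \<times> Inr ` {..<n'}) (Inr ` {..<m'} \<times> Inl ` {..<n}))"
  (is "?P = graph_union ?A ?B")
proof -
  have "vertices ?P = vertices (graph_union ?A ?B)"
    by (auto simp: direct_product_def complete_bipartite_def)
  moreover have "edges ?P = edges (graph_union ?A ?B)"
  proof
    show "edges ?P \<subseteq> edges (graph_union ?A ?B)"
      by (auto simp: direct_product_def complete_bipartite_def edges_biclique doubleton_eq_iff)
        fastforce+
    show "edges (graph_union ?A ?B) \<subseteq> edges ?P"
      by (auto simp: direct_product_def complete_bipartite_def edges_biclique doubleton_eq_iff)
        fastforce+
  qed
  ultimately show ?thesis by (cases ?P) (simp add: graph_union_def)
qed

text \<open>A product of bounded factors reaches the product of positive bounds only if neither
  factor falls short. This identifies when a balanced component attains the maximum degree.\<close>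

lemma mult_eq_mult_imp_eq:
  fixes a b M N :: nat
  assumes "a * b = M * N" "a \<le> M" "b \<le> N" "0 < M" "0 < N"
  shows "a = M \<and> b = N"
proof -
  have "M * N \<le> a * N" "M * N \<le> M * b"
    using mult_le_mono2[OF assms(3), of a] mult_le_mono1[OF assms(2), of b] assms(1) by simp_all
  then have "M \<le> a" "N \<le> b" using assms(4,5) by simp_all
  then show ?thesis using assms(2,3) by simp
qed

theorem mainTheorem4:
  fixes m m' n n' :: nat
  assumes "m \<ge> 1" and "m' \<ge> 1" and "n \<ge> 1" and "n' \<ge> 1"
  defines "G \<equiv> direct_product (complete_bipartite m m') (complete_bipartite n n')"
  shows "(type2 G \<longleftrightarrow> m = m' \<and> n = n') \<and> (\<not> (m = m' \<and> n = n') \<longrightarrow> type1 G)"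
proof -
  let ?L1 = "Inl ` {..<m} \<times> Inl ` {..<n} :: ((nat + nat) \<times> (nat + nat)) set"
  let ?R1 = "Inr ` {..<m'} \<times> Inr ` {..<n'} :: ((nat + nat) \<times> (nat + nat)) set"
  let ?L2 = "Inl ` {..<m} \<times> Inr ` {..<n'} :: ((nat + nat) \<times> (nat + nat)) set"
  let ?R2 = "Inr ` {..<m'} \<times> Inl ` {..<n} :: ((nat + nat) \<times> (nat + nat)) set"
  have G: "G = graph_union (biclique ?L1 ?R1) (biclique ?L2 ?R2)"
    unfolding G_def by (rule direct_product_complete_bipartite)
  have disj: "?L1 \<inter> ?R1 = {}" "?L2 \<inter> ?R2 = {}"
    "vertices (biclique ?L1 ?R1) \<inter> vertices (biclique ?L2 ?R2) = {}"
    by auto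
  have ne: "?L1 \<noteq> {}" "?R1 \<noteq> {}" "?L2 \<noteq> {}" "?R2 \<noteq> {}"
    using assms(1-4) by (auto simp: lessThan_empty_iff)
  have fsg: "finite_simple_graph (biclique ?L1 ?R1)" "finite_simple_graph (biclique ?L2 ?R2)"
    using disj by (auto intro!: finite_simple_graph_biclique)
  have card: "card ?L1 = m * n" "card ?R1 = m' * n'" "card ?L2 = m * n'" "card ?R2 = m' * n"
    by (simp_all add: card_cartesian_product card_image)
  define M N where "M = max m m'" and "N = max n n'"
  \<comment> \<open>The four part sizes are all products of one of \<open>m\<close>,
    \<open>m'\<close> with one of \<open>n\<close>, \<open>n'\<close>, so their maximum factors. It
    is the maximum degree of \<open>G\<close>.\<close>
  have max: "max (max (m * n) (m' * n')) (max (m * n') (m' * n)) = M * N"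
    unfolding M_def N_def by (simp add: nat_mult_max_left nat_mult_max_right max.assoc max.commute max.left_commute)
  have Delta: "max_degree G = M * N"
    using max_degree_graph_union[OF fsg disj(3)] ne
      max_degree_biclique[OF disj(1) ne(1,2)] max_degree_biclique[OF disj(2) ne(3,4)]
    unfolding G card by (simp add: max)
  have chi: "total_chromatic_number G =
      max (max (m * n) (m' * n') + (if m * n = m' * n' then 2 else 1))
        (max (m * n') (m' * n) + (if m * n' = m' * n then 2 else 1))"
    using total_chromatic_number_graph_union[OF fsg disj(3)]
      total_chromatic_number_biclique[OF _ _ disj(1) ne(1,2)]
      total_chromatic_number_biclique[OF _ _ disj(2) ne(3,4)]
    unfolding G card by simp
  show ?thesis
  proof (cases "m = m' \<and> n = n'")
    case True
    then show ?thesis using chi max by (simp add: type2_def Delta)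
  next
    case False
    have bounds: "m \<le> M" "m' \<le> M" "n \<le> N" "n' \<le> N" "0 < M" "0 < N"
      using assms(1-4) by (auto simp: M_def N_def)
    \<comment> \<open>A balanced component pushes the number of colors to \<open>M * N + 2\<close>
      only if its parts have size \<open>M * N\<close>. Then all four factors would attain their
      bounds, forcing the excluded equalities.\<close>
    have "m * n < M * N" if "m * n = m' * n'"
    proof (rule ccontr)
      assume "\<not> m * n < M * N"
      then have "m * n = M * N" using max by linarith
      then show False
        using False that bounds mult_eq_mult_imp_eq[of m n M N] mult_eq_mult_imp_eq[of m' n' M N] by simp
    qed
    moreover have "m * n' < M * N" if "m * n' = m' * n"
    proof (rule ccontr)
      assume "\<not> m * n' < M * N"
      then have "m * n' = M * N" using max by linarith
      then show False
        using False that bounds mult_eq_mult_imp_eq[of m n' M N] mult_eq_mult_imp_eq[of m' n M N] by simp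
    qed
    \<comment> \<open>A balanced component has parts smaller than \<open>M * N\<close> and needs at
      most \<open>M * N + 1\<close> colors. Some component attains \<open>M * N\<close>; it is
      unbalanced and needs exactly \<open>M * N + 1\<close>.\<close>
    ultimately have "total_chromatic_number G = M * N + 1"
      using chi max by (auto split: if_splits)
    then show ?thesis using False by (simp add: type1_def type2_def Delta)
  qed
qed

end
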